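(* Let $n\geqslant 3$ and $r\geqslant 1$, and let $\rho:WB_n\to GL_r(\mathbb{C})$ be an $r$-dimensional representation of the welded braid group $WB_n$ such that the restriction $\rho|_{B_n}$ of $\rho$ to the braid group $B_n$ is irreducible. Then $\rho$ is not faithful.
   Context: The welded braid group $WB_n$ is the group generated by $\alpha_1,\dots,\alpha_{n-1},\sigma_1,\dots,\sigma_{n-1}$ with defining relations: $\alpha_i^2=1$ ($1\leqslant i\leqslant n-1$); $\alpha_i\alpha_j=\alpha_j\alpha_i$, $\sigma_i\sigma_j=\sigma_j\sigma_i$, $\alpha_i\sigma_j=\sigma_j\alpha_i$ for $|i-j|\geqslant 2$; and, for $1\leqslant i\leqslant n-2$, $\alpha_i\alpha_{i+1}\alpha_i=\alpha_{i+1}\alpha_i\alpha_{i+1}$, $\sigma_i\sigma_{i+1}\sigma_i=\sigma_{i+1}\sigma_i\sigma_{i+1}$, $\alpha_i\alpha_{i+1}\sigma_i=\sigma_{i+1}\alpha_i\alpha_{i+1}$, $\sigma_i\sigma_{i+1}\alpha_i=\alpha_{i+1}\sigma_i\sigma_{i+1}$. The subgroup generated by $\sigma_1,\dots,\sigma_{n-1}$ is isomorphic to the braid group on $n$ strings and is denoted $B_n$. *)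

theory Defs
  imports "Jordan_Normal_Form.VS_Connect" "HOL-Algebra.Generated_Groups"
begin

section \<open>Groups given by generators and relations\<close>

text \<open>Group words over an alphabet: \<open>(g, True)\<close> is the letter \<open>g\<close>, \<open>(g, False)\<close> its formal inverse.\<close>

type_synonym 'g gword = "('g \<times> bool) list"

definition gwords :: "'g set \<Rightarrow> 'g gword set" where
  "gwords S = lists (S \<times> UNIV)"

text \<open>
  The congruence on words over \<open>S\<close> generated by free cancellation and by the relations
  \<open>u = v\<close> for \<open>(u, v) \<in> R\<close>.
\<close>

inductive_set pres_rel :: "'g set \<Rightarrow> ('g gword \<times> 'g gword) set \<Rightarrow> ('g gword \<times> 'g gword) set"
  for S :: "'g set" and R :: "('g gword \<times> 'g gword) set" where
  relation: "(u, v) \<in> R \<Longrightarrow> u \<in> gwords S \<Longrightarrow> v \<in> gwords S \<Longrightarrow> (u, v) \<in> pres_rel S R"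
| cancel: "g \<in> S \<Longrightarrow> ([(g, b), (g, \<not> b)], []) \<in> pres_rel S R"
| refl: "u \<in> gwords S \<Longrightarrow> (u, u) \<in> pres_rel S R"
| sym: "(u, v) \<in> pres_rel S R \<Longrightarrow> (v, u) \<in> pres_rel S R"
| trans: "(u, v) \<in> pres_rel S R \<Longrightarrow> (v, w) \<in> pres_rel S R \<Longrightarrow> (u, w) \<in> pres_rel S R"
| append: "(u, v) \<in> pres_rel S R \<Longrightarrow> (u', v') \<in> pres_rel S R
    \<Longrightarrow> (u @ u', v @ v') \<in> pres_rel S R"

definition presented_group ::
    "'g set \<Rightarrow> ('g gword \<times> 'g gword) set \<Rightarrow> 'g gword set monoid" where
  "presented_group S R =
    \<lparr> carrier = gwords S // pres_rel S R,
      mult = (\<lambda>X Y. \<Union>u\<in>X. \<Union>v\<in>Y. pres_rel S R `` {u @ v}),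
      one = pres_rel S R `` {[]} \<rparr>"

definition gen_class :: "'g set \<Rightarrow> ('g gword \<times> 'g gword) set \<Rightarrow> 'g \<Rightarrow> 'g gword set" where
  "gen_class S R g = pres_rel S R `` {[(g, True)]}"

lemma gwords_append [simp]: "u @ v \<in> gwords S \<longleftrightarrow> u \<in> gwords S \<and> v \<in> gwords S"
  by (auto simp: gwords_def)

lemma gwords_Nil [simp]: "[] \<in> gwords S"
  by (simp add: gwords_def)

lemma pres_rel_gwords: "(u, v) \<in> pres_rel S R \<Longrightarrow> u \<in> gwords S \<and> v \<in> gwords S"
  by (induction rule: pres_rel.induct) (auto simp: gwords_def)

lemma equiv_pres_rel: "equiv (gwords S) (pres_rel S R)"
proof (rule equivI)
  show "pres_rel S R \<subseteq> gwords S \<times> gwords S"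
    using pres_rel_gwords by auto
  show "refl_on (gwords S) (pres_rel S R)"
    by (intro refl_onI) (rule pres_rel.refl)
  show "sym (pres_rel S R)"
    by (rule symI) (rule pres_rel.sym)
  show "Relation.trans (pres_rel S R)"
    by (rule transI) (rule pres_rel.trans)
qed

lemma presented_group_mult:
  assumes "u \<in> gwords S" "v \<in> gwords S"
  shows "mult (presented_group S R) (pres_rel S R `` {u}) (pres_rel S R `` {v})
    = pres_rel S R `` {u @ v}"
proof -
  have cl: "pres_rel S R `` {u' @ v'} = pres_rel S R `` {u @ v}"
    if "(u, u') \<in> pres_rel S R" "(v, v') \<in> pres_rel S R" for u' v'
    using equiv_class_eq[OF equiv_pres_rel pres_rel.append[OF that]] by simp
  have "(\<Union>u'\<in>pres_rel S R `` {u}. \<Union>v'\<in>pres_rel S R `` {v}. pres_rel S R `` {u' @ v'})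
      = (\<Union>u'\<in>pres_rel S R `` {u}. \<Union>v'\<in>pres_rel S R `` {v}. pres_rel S R `` {u @ v})"
    by (intro SUP_cong[OF HOL.refl]) (simp only: Image_singleton_iff cl)
  also have "\<dots> = pres_rel S R `` {u @ v}"
    using pres_rel.refl[OF assms(1)] pres_rel.refl[OF assms(2)] by blast
  finally show ?thesis by (simp only: presented_group_def monoid.simps)
qed

lemma presented_group_carrierE:
  assumes "X \<in> carrier (presented_group S R)"
  obtains u where "u \<in> gwords S" "X = pres_rel S R `` {u}"
  using assms by (auto simp: presented_group_def elim: quotientE)

lemma presented_group_carrierI:
  "u \<in> gwords S \<Longrightarrow> pres_rel S R `` {u} \<in> carrier (presented_group S R)"
  by (auto simp: presented_group_def intro: quotientI)

lemma presented_group_one: "one (presented_group S R) = pres_rel S R `` {[]}"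
  by (simp add: presented_group_def)

lemma pres_rel_left_inverse:
  assumes "u \<in> gwords S"
  shows "\<exists>v\<in>gwords S. (v @ u, []) \<in> pres_rel S R"
  using assms
proof (induction u)
  case Nil
  then show ?case by (force intro: pres_rel.refl)
next
  case (Cons x u)
  obtain g b where x: "x = (g, b)" by (cases x)
  from Cons obtain v where v: "v \<in> gwords S" "(v @ u, []) \<in> pres_rel S R"
    by (auto simp: gwords_def)
  from Cons.prems x have g: "g \<in> S" and u: "u \<in> gwords S" by (auto simp: gwords_def)
  have "([(g, \<not> b), (g, b)], []) \<in> pres_rel S R"
    using pres_rel.cancel[OF g, of "\<not> b"] by simp
  from pres_rel.append[OF pres_rel.append[OF pres_rel.refl[OF v(1)] this] pres_rel.refl[OF u]]
  have "(v @ [(g, \<not> b), (g, b)] @ u, v @ u) \<in> pres_rel S R" by simp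
  from pres_rel.trans[OF this v(2)]
  have "((v @ [(g, \<not> b)]) @ x # u, []) \<in> pres_rel S R" by (simp add: x)
  moreover have "v @ [(g, \<not> b)] \<in> gwords S" using v g by (auto simp: gwords_def)
  ultimately show ?case by blast
qed

lemma group_presented_group: "group (presented_group S R)"
proof (rule groupI)
  let ?G = "presented_group S R"
  fix X assume X: "X \<in> carrier ?G"
  then obtain u where u: "u \<in> gwords S" "X = pres_rel S R `` {u}"
    by (rule presented_group_carrierE)
  show "mult ?G (one ?G) X = X"
    using u by (simp only: presented_group_one presented_group_mult gwords_Nil append_Nil)
  obtain v where v: "v \<in> gwords S" and "(v @ u, []) \<in> pres_rel S R"
    using pres_rel_left_inverse[OF u(1)] by blast
  then have "mult ?G (pres_rel S R `` {v}) X = one ?G"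
    using u equiv_class_eq[OF equiv_pres_rel]
    by (simp only: presented_group_one presented_group_mult)
  then show "\<exists>Y\<in>carrier ?G. mult ?G Y X = one ?G"
    using presented_group_carrierI[OF v] by blast
  fix Y assume "Y \<in> carrier ?G"
  then obtain w' where v: "w' \<in> gwords S" "Y = pres_rel S R `` {w'}"
    by (rule presented_group_carrierE)
  show "mult ?G X Y \<in> carrier ?G"
    using u v by (simp only: presented_group_mult presented_group_carrierI gwords_append)
  fix Z assume "Z \<in> carrier ?G"
  then obtain w where w: "w \<in> gwords S" "Z = pres_rel S R `` {w}"
    by (rule presented_group_carrierE)
  show "mult ?G (mult ?G X Y) Z = mult ?G X (mult ?G Y Z)"
    using u v w by (simp only: presented_group_mult gwords_append append_assoc)
next
  show "one (presented_group S R) \<in> carrier (presented_group S R)"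
    by (simp add: presented_group_one presented_group_carrierI)
qed


section \<open>The welded braid group and its braid subgroup\<close>

datatype wb_gen = Alpha nat | Sigma nat

abbreviation wb_a :: "nat \<Rightarrow> wb_gen gword" where "wb_a i \<equiv> [(Alpha i, True)]"
abbreviation wb_s :: "nat \<Rightarrow> wb_gen gword" where "wb_s i \<equiv> [(Sigma i, True)]"

definition wb_gens :: "nat \<Rightarrow> wb_gen set" where
  "wb_gens n = Alpha ` {1..n-1} \<union> Sigma ` {1..n-1}"

definition wb_rels :: "nat \<Rightarrow> (wb_gen gword \<times> wb_gen gword) set" where
  "wb_rels n =
     {(wb_a i @ wb_a i, []) | i. i \<in> {1..n-1}}
   \<union> {(wb_a i @ wb_a j, wb_a j @ wb_a i) | i j.
        i \<in> {1..n-1} \<and> j \<in> {1..n-1} \<and> 2 \<le> \<bar>int i - int j\<bar>}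
   \<union> {(wb_s i @ wb_s j, wb_s j @ wb_s i) | i j.
        i \<in> {1..n-1} \<and> j \<in> {1..n-1} \<and> 2 \<le> \<bar>int i - int j\<bar>}
   \<union> {(wb_a i @ wb_s j, wb_s j @ wb_a i) | i j.
        i \<in> {1..n-1} \<and> j \<in> {1..n-1} \<and> 2 \<le> \<bar>int i - int j\<bar>}
   \<union> {(wb_a i @ wb_a (i+1) @ wb_a i, wb_a (i+1) @ wb_a i @ wb_a (i+1)) | i. i \<in> {1..n-2}}
   \<union> {(wb_s i @ wb_s (i+1) @ wb_s i, wb_s (i+1) @ wb_s i @ wb_s (i+1)) | i. i \<in> {1..n-2}}
   \<union> {(wb_a i @ wb_a (i+1) @ wb_s i, wb_s (i+1) @ wb_a i @ wb_a (i+1)) | i. i \<in> {1..n-2}}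
   \<union> {(wb_s i @ wb_s (i+1) @ wb_a i, wb_a (i+1) @ wb_s i @ wb_s (i+1)) | i. i \<in> {1..n-2}}"

definition WB :: "nat \<Rightarrow> wb_gen gword set monoid" where
  "WB n = presented_group (wb_gens n) (wb_rels n)"

definition wb_sigma :: "nat \<Rightarrow> nat \<Rightarrow> wb_gen gword set" where
  "wb_sigma n i = gen_class (wb_gens n) (wb_rels n) (Sigma i)"

definition braid_subgroup :: "nat \<Rightarrow> wb_gen gword set monoid" where
  "braid_subgroup n = (WB n)\<lparr>carrier := generate (WB n) (wb_sigma n ` {1..n-1})\<rparr>"

lemma group_WB: "group (WB n)"
  by (simp add: WB_def group_presented_group)


section \<open>Complex matrix representations\<close>

definition GL :: "nat \<Rightarrow> complex mat monoid" where
  "GL r = units_of (ring_mat TYPE(complex) r ())"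

definition irreducible_rep ::
    "nat \<Rightarrow> ('a, 'b) monoid_scheme \<Rightarrow> ('a \<Rightarrow> complex mat) \<Rightarrow> bool" where
  "irreducible_rep r G \<rho> \<longleftrightarrow>
     \<rho> \<in> hom G (GL r) \<and> r \<ge> 1 \<and>
     (\<forall>W. VectorSpace.subspace class_ring W (module_vec TYPE(complex) r) \<longrightarrow>
        (\<forall>g\<in>carrier G. \<forall>w\<in>W. \<rho> g *\<^sub>v w \<in> W) \<longrightarrow>
        W = {0\<^sub>v r} \<or> W = carrier_vec r)"

end

theory Submission
  imports Defs "Jordan_Normal_Form.Spectral_Radius"
begin

text \<open>
  The braid group has a central element, the full twist
  \<open>\<Delta>\<^sup>2 = (\<sigma>\<^sub>1 \<dots> \<sigma>\<^bsub>n-1\<^esub>)\<^sup>n\<close>, which is not central in the welded braid group.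
  If the restriction of \<open>\<rho>\<close> to the braid group is irreducible, Schur's lemma forces \<open>\<rho> (\<Delta>\<^sup>2)\<close> to be a
  scalar matrix (\<open>schur_scalar\<close>, \<open>full_twist_central\<close>). A scalar matrix commutes with every
  matrix, in particular with \<open>\<rho> \<alpha>\<^sub>1\<close>. So \<open>\<rho>\<close> sends \<open>\<Delta>\<^sup>2 \<alpha>\<^sub>1\<close> and \<open>\<alpha>\<^sub>1 \<Delta>\<^sup>2\<close> to the same matrix, and it
  remains to see that these two elements differ (\<open>full_twist_not_commuting\<close>).

  To tell them apart, the welded braid group is made to act on colourings of the strands by
  integers: \<open>\<alpha>\<^sub>i\<close> swaps the colours in positions \<open>i\<close> and \<open>i + 1\<close>, while \<open>\<sigma>\<^sub>i\<close> swaps them and moreover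
  reflects one in the other, turning \<open>(a, b)\<close> into \<open>(2 a - b, a)\<close>. These are the Fox colourings, or
  equivalently the Burau representation at \<open>t = -1\<close> extended by permutation matrices. The full
  twist applies to all colours the composition of the reflections
  in the points \<open>x\<^sub>1, \<dots>, x\<^sub>n\<close>; its translation part is twice the alternating sum
  \<open>x\<^sub>1 - x\<^sub>2 + x\<^sub>3 - \<dots>\<close>, and exchanging \<open>x\<^sub>1\<close> with \<open>x\<^sub>2\<close> changes this sum.
\<close>

section \<open>Schur's lemma over the complex numbers\<close>

text \<open>
  An eigenspace of \<open>A\<close> is invariant under everything that commutes with \<open>A\<close>. Since \<open>\<complex>\<close> is
  algebraically closed, some eigenspace is nonzero; by irreducibility it is the whole space.
\<close>

lemma schur_scalar:
  fixes A :: "complex mat"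
  assumes irr: "irreducible_rep r G \<rho>"
    and A: "A \<in> carrier_mat r r"
    and comm: "\<And>g. g \<in> carrier G \<Longrightarrow> A * \<rho> g = \<rho> g * A"
  shows "\<exists>c. A = c \<cdot>\<^sub>m 1\<^sub>m r"
proof -
  have "r > 0"
    using irr by (simp add: irreducible_rep_def)
  then obtain c v where v: "v \<in> carrier_vec r" "v \<noteq> 0\<^sub>v r" "A *\<^sub>v v = c \<cdot>\<^sub>v v"
    using spectrum_non_empty[OF A] A
    by (auto simp: spectrum_def eigenvalue_def eigenvector_def)
  define W where "W = {w \<in> carrier_vec r. A *\<^sub>v w = c \<cdot>\<^sub>v w}"
  have "VectorSpace.subspace class_ring W (module_vec TYPE(complex) r)"
  proof (rule VectorSpace.subspace.intro[OF vec_vs], rule submodule.intro[OF vec_module])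
    show "W \<subseteq> carrier (module_vec TYPE(complex) r)"
      by (auto simp: W_def module_vec_simps)
    show "\<zero>\<^bsub>module_vec TYPE(complex) r\<^esub> \<in> W"
      using A by (auto simp: W_def module_vec_simps)
  next
    fix x y assume "x \<in> W" "y \<in> W"
    then show "x \<oplus>\<^bsub>module_vec TYPE(complex) r\<^esub> y \<in> W"
      using A by (auto simp: W_def module_vec_simps mult_add_distrib_mat_vec
          smult_add_distrib_vec)
  next
    fix k :: complex and x assume "x \<in> W"
    then show "k \<odot>\<^bsub>module_vec TYPE(complex) r\<^esub> x \<in> W"
      using A by (auto simp: W_def module_vec_simps mult_mat_vec smult_smult_assoc
          mult.commute)
  qed
  moreover have "\<rho> g *\<^sub>v w \<in> W" if g: "g \<in> carrier G" and w: "w \<in> W" for g w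
  proof -
    have R: "\<rho> g \<in> carrier_mat r r"
      using irr g by (auto simp: irreducible_rep_def GL_def hom_def units_of_def Units_def
          ring_mat_simps)
    have "A *\<^sub>v (\<rho> g *\<^sub>v w) = (A * \<rho> g) *\<^sub>v w"
      using A R w by (simp add: W_def)
    also have "\<dots> = \<rho> g *\<^sub>v (A *\<^sub>v w)"
      using A R w by (simp add: W_def comm[OF g])
    also have "\<dots> = c \<cdot>\<^sub>v (\<rho> g *\<^sub>v w)"
      using R w by (simp add: W_def mult_mat_vec)
    finally show ?thesis
      using R w by (simp add: W_def)
  qed
  ultimately have "W = {0\<^sub>v r} \<or> W = carrier_vec r"
    using irr by (auto simp: irreducible_rep_def)
  moreover have "v \<in> W"
    using v by (simp add: W_def)
  ultimately have W: "W = carrier_vec r"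
    using v by auto
  \<comment> \<open>Every unit vector is now an eigenvector for \<open>c\<close>, which determines each column of \<open>A\<close>.\<close>
  have "A = c \<cdot>\<^sub>m 1\<^sub>m r"
  proof (rule mat_col_eqI)
    fix j assume "j < dim_col (c \<cdot>\<^sub>m 1\<^sub>m r)"
    then have j: "j < r" by simp
    have "col A j = col (A * 1\<^sub>m r) j"
      using A by simp
    also have "\<dots> = A *\<^sub>v unit_vec r j"
      using A j col_mult2[OF A one_carrier_mat j] by simp
    also have "\<dots> = c \<cdot>\<^sub>v unit_vec r j"
    proof -
      have "unit_vec r j \<in> W"
        by (simp add: W)
      then show ?thesis
        by (simp add: W_def)
    qed
    also have "\<dots> = col (c \<cdot>\<^sub>m 1\<^sub>m r) j"
      using j by (intro eq_vecI) auto
    finally show "col A j = col (c \<cdot>\<^sub>m 1\<^sub>m r) j" .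
  qed (use A in auto)
  then show ?thesis ..
qed

section \<open>The full twist is central in the braid group\<close>

text \<open>
  The elements \<open>s 1, \<dots>, s m\<close> of an arbitrary group satisfy the relations of the braid group on
  \<open>m + 1\<close> strings. They may satisfy further relations, so that the results apply to the braid
  generators inside a larger group.
\<close>

locale braid_relations = group G for G (structure) +
  fixes s :: "nat \<Rightarrow> 'a" and m :: nat
  assumes s_closed: "\<lbrakk>1 \<le> i; i \<le> m\<rbrakk> \<Longrightarrow> s i \<in> carrier G"
    and far_commute: "\<lbrakk>1 \<le> i; i + 2 \<le> j; j \<le> m\<rbrakk> \<Longrightarrow> s i \<otimes> s j = s j \<otimes> s i"
    and braid: "\<lbrakk>1 \<le> i; i < m\<rbrakk>
      \<Longrightarrow> s i \<otimes> s (i + 1) \<otimes> s i = s (i + 1) \<otimes> s i \<otimes> s (i + 1)"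
begin

text \<open>
  \<open>delta a k\<close> is the product of the \<open>k\<close> consecutive generators \<open>s a, \<dots>, s (a + k - 1)\<close>. The start
  index is variable because conjugation by \<open>delta 1 m\<close> moves \<open>delta 1 k\<close> to \<open>delta 2 k\<close>.
\<close>

primrec delta :: "nat \<Rightarrow> nat \<Rightarrow> 'a" where
  "delta a 0 = \<one>"
| "delta a (Suc k) = delta a k \<otimes> s (a + k)"

lemma delta_closed: "\<lbrakk>1 \<le> a; a + k \<le> Suc m\<rbrakk> \<Longrightarrow> delta a k \<in> carrier G"
  by (induction k) (auto simp: s_closed)

lemma delta_far_commute:
  "\<lbrakk>1 \<le> a; a + k < j; j \<le> m\<rbrakk> \<Longrightarrow> delta a k \<otimes> s j = s j \<otimes> delta a k"
proof (induction k)
  case (Suc k)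
  have c: "delta a k \<in> carrier G" "s (a + k) \<in> carrier G" "s j \<in> carrier G"
    using Suc.prems by (auto simp: delta_closed s_closed)
  have "delta a (Suc k) \<otimes> s j = delta a k \<otimes> (s (a + k) \<otimes> s j)"
    using c by (simp add: m_assoc)
  also have "\<dots> = delta a k \<otimes> s j \<otimes> s (a + k)"
    using c Suc.prems by (simp add: far_commute m_assoc)
  also have "\<dots> = s j \<otimes> delta a (Suc k)"
    using c Suc by (simp add: m_assoc)
  finally show ?case .
qed (auto simp: s_closed)

text \<open>
  Moving \<open>s i\<close> leftwards through \<open>s 1 \<otimes> \<dots> \<otimes> s k\<close>, it passes the factors beyond \<open>s (i + 1)\<close>
  unchanged, becomes \<open>s (i + 1)\<close> at \<open>s i \<otimes> s (i + 1)\<close> by the braid relation, and then passes the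
  factors before \<open>s i\<close>.
\<close>

lemma delta_shift_generator:
  "\<lbrakk>1 \<le> i; i < k; k \<le> m\<rbrakk> \<Longrightarrow> delta 1 k \<otimes> s i = s (i + 1) \<otimes> delta 1 k"
proof (induction k)
  case (Suc k)
  have c: "delta 1 k \<in> carrier G" "s (Suc k) \<in> carrier G" "s i \<in> carrier G"
      "s (i + 1) \<in> carrier G"
    using Suc.prems by (auto simp: delta_closed s_closed)
  show ?case
  proof (cases "i < k")
    case True
    have "delta 1 (Suc k) \<otimes> s i = delta 1 k \<otimes> (s (Suc k) \<otimes> s i)"
      using c by (simp add: m_assoc)
    also have "\<dots> = delta 1 k \<otimes> s i \<otimes> s (Suc k)"
      using c True Suc.prems far_commute[of i "Suc k"] by (simp add: m_assoc)
    also have "\<dots> = s (i + 1) \<otimes> delta 1 (Suc k)"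
      using c True Suc by (simp add: m_assoc)
    finally show ?thesis .
  next
    case False
    with Suc.prems obtain l where k: "k = Suc l" and i: "i = Suc l"
      by (cases k; cases i) auto
    have d: "delta 1 l \<in> carrier G"
      using Suc.prems k by (auto intro: delta_closed)
    have "delta 1 (Suc k) \<otimes> s i = delta 1 l \<otimes> (s (Suc l) \<otimes> s (Suc l + 1) \<otimes> s (Suc l))"
      using c d by (simp add: k i m_assoc)
    also have "\<dots> = delta 1 l \<otimes> s (Suc l + 1) \<otimes> s (Suc l) \<otimes> s (Suc l + 1)"
      using c d Suc.prems braid[of "Suc l"] by (simp add: k i m_assoc)
    also have "delta 1 l \<otimes> s (Suc l + 1) = s (Suc l + 1) \<otimes> delta 1 l"
      using Suc.prems by (intro delta_far_commute) (auto simp: k)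
    finally show ?thesis
      using c d by (simp add: k i m_assoc)
  qed
qed simp

lemma delta_shift_product:
  "k < m \<Longrightarrow> delta 1 m \<otimes> delta 1 k = delta 2 k \<otimes> delta 1 m"
proof (induction k)
  case (Suc k)
  have c: "delta 1 m \<in> carrier G" "delta 1 k \<in> carrier G" "delta 2 k \<in> carrier G"
    "s (Suc k) \<in> carrier G" "s (Suc k + 1) \<in> carrier G"
    using Suc.prems by (auto simp: delta_closed s_closed)
  have "delta 1 m \<otimes> delta 1 (Suc k) = delta 2 k \<otimes> (delta 1 m \<otimes> s (Suc k))"
    using c Suc by (simp add: m_assoc[symmetric])
  also have "\<dots> = delta 2 (Suc k) \<otimes> delta 1 m"
    using c Suc.prems delta_shift_generator[of "Suc k" m] by (simp add: m_assoc)
  finally show ?case .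
qed (auto simp: delta_closed)

lemma delta_split_first:
  "k < m \<Longrightarrow> delta 1 (Suc k) = s 1 \<otimes> delta 2 k"
proof (induction k)
  case (Suc k)
  then show ?case
    using delta_closed[of 2 k] s_closed[of 1] s_closed[of "Suc (Suc k)"]
    by (simp add: m_assoc)
qed (simp add: s_closed)

text \<open>
  Conjugation by \<open>\<delta> = delta 1 m\<close> shifts \<open>s 1, \<dots>, s (m - 1)\<close> by one step; what it does to the last
  generator is less transparent, but \<open>\<delta>\<^sup>2\<close> carries it back to the first one. This closes the cycle
  of length \<open>m + 1\<close> that makes \<open>\<delta>\<close> to the power \<open>m + 1\<close> central. The reason is that
  \<open>\<delta> \<otimes> \<delta> = \<delta> \<otimes> (s 1 \<otimes> \<dots> \<otimes> s (m - 1)) \<otimes> s m = (s 2 \<otimes> \<dots> \<otimes> s m) \<otimes> \<delta> \<otimes> s m\<close>, and multiplying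
  by \<open>s 1\<close> on the left completes the first bracket to \<open>\<delta>\<close>.
\<close>

lemma delta_square_wraps:
  assumes "1 \<le> m"
  shows "delta 1 m \<otimes> delta 1 m \<otimes> s m = s 1 \<otimes> (delta 1 m \<otimes> delta 1 m)"
proof -
  obtain k where k: "m = Suc k"
    using assms by (cases m) auto
  have c: "delta 1 m \<in> carrier G" "delta 1 k \<in> carrier G" "delta 2 k \<in> carrier G"
    "s 1 \<in> carrier G" "s m \<in> carrier G"
    using k by (auto simp: delta_closed s_closed)
  have "delta 1 m \<otimes> delta 1 m = delta 1 m \<otimes> delta 1 k \<otimes> s m"
    using c by (simp add: k m_assoc)
  also have "\<dots> = delta 2 k \<otimes> delta 1 m \<otimes> s m"
    using delta_shift_product[of k] by (simp add: k)
  finally have "s 1 \<otimes> (delta 1 m \<otimes> delta 1 m) = s 1 \<otimes> delta 2 k \<otimes> delta 1 m \<otimes> s m"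
    using c by (simp add: m_assoc)
  then show ?thesis
    using delta_split_first[of k] k by simp
qed

lemma delta_pow_shift:
  "j < m \<Longrightarrow> delta 1 m [^] j \<otimes> s 1 = s (Suc j) \<otimes> delta 1 m [^] j"
proof (induction j)
  case (Suc j)
  have c: "delta 1 m \<in> carrier G" "s 1 \<in> carrier G" "s (Suc j) \<in> carrier G"
    "s (Suc j + 1) \<in> carrier G"
    using Suc.prems by (auto simp: delta_closed s_closed)
  have "delta 1 m [^] Suc j \<otimes> s 1 = delta 1 m \<otimes> (delta 1 m [^] j \<otimes> s 1)"
    using c by (metis m_assoc nat_pow_Suc2 nat_pow_closed)
  also have "\<dots> = delta 1 m \<otimes> s (Suc j) \<otimes> delta 1 m [^] j"
    using c Suc by (simp add: m_assoc)
  also have "\<dots> = s (Suc j + 1) \<otimes> delta 1 m \<otimes> delta 1 m [^] j"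
    using Suc.prems by (subst delta_shift_generator) auto
  also have "\<dots> = s (Suc (Suc j)) \<otimes> delta 1 m [^] Suc j"
    using c by (simp only: m_assoc nat_pow_closed nat_pow_Suc2) simp
  finally show ?case .
qed (simp add: s_closed)

definition full_twist :: 'a where
  "full_twist = delta 1 m [^] Suc m"

lemma full_twist_closed: "full_twist \<in> carrier G"
  unfolding full_twist_def by (intro nat_pow_closed delta_closed) auto

text \<open>
  The factor \<open>\<delta>\<close> to the power \<open>m - 1\<close> carries \<open>s 1\<close> up to \<open>s m\<close>, and the remaining \<open>\<delta>\<^sup>2\<close> carries
  \<open>s m\<close> back to \<open>s 1\<close>.
\<close>

lemma full_twist_commutes_first:
  assumes "1 \<le> m"
  shows "full_twist \<otimes> s 1 = s 1 \<otimes> full_twist"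
proof -
  let ?d = "delta 1 m"
  have c: "?d \<in> carrier G" "s 1 \<in> carrier G" "s m \<in> carrier G"
    using assms by (auto simp: delta_closed s_closed)
  have split: "full_twist = ?d \<otimes> ?d \<otimes> ?d [^] (m - 1)"
    using assms c nat_pow_Suc2[of ?d m] nat_pow_Suc2[of ?d "m - 1"]
    by (simp add: m_assoc full_twist_def)
  have "full_twist \<otimes> s 1 = ?d \<otimes> ?d \<otimes> (?d [^] (m - 1) \<otimes> s 1)"
    unfolding split using c by (simp add: m_assoc)
  also have "?d [^] (m - 1) \<otimes> s 1 = s m \<otimes> ?d [^] (m - 1)"
    using delta_pow_shift[of "m - 1"] assms by simp
  also have "?d \<otimes> ?d \<otimes> (s m \<otimes> ?d [^] (m - 1)) = ?d \<otimes> ?d \<otimes> s m \<otimes> ?d [^] (m - 1)"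
    using c by (simp add: m_assoc)
  also have "\<dots> = s 1 \<otimes> full_twist"
    unfolding split delta_square_wraps[OF assms] using c by (simp add: m_assoc)
  finally show ?thesis .
qed

text \<open>
  Every generator is conjugate to \<open>s 1\<close> by a power of \<open>\<delta>\<close>, and these powers commute with the full
  twist, which is itself a power of \<open>\<delta>\<close>.
\<close>

lemma full_twist_commutes_generator:
  assumes "1 \<le> i" "i \<le> m"
  shows "full_twist \<otimes> s i = s i \<otimes> full_twist"
proof -
  let ?p = "delta 1 m [^] (i - 1)"
  have d: "delta 1 m \<in> carrier G"
    by (simp add: delta_closed)
  have c: "full_twist \<in> carrier G" "?p \<in> carrier G" "s 1 \<in> carrier G" "s i \<in> carrier G"
    using assms d by (auto simp: s_closed full_twist_closed)
  have zp: "full_twist \<otimes> ?p = ?p \<otimes> full_twist"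
    unfolding full_twist_def using d by (simp only: nat_pow_mult add.commute)
  have shift: "?p \<otimes> s 1 = s i \<otimes> ?p"
    using delta_pow_shift[of "i - 1"] assms by simp
  have first: "full_twist \<otimes> s 1 = s 1 \<otimes> full_twist"
    using assms by (intro full_twist_commutes_first) simp
  have "full_twist \<otimes> s i \<otimes> ?p = full_twist \<otimes> ?p \<otimes> s 1"
    using c shift by (simp add: m_assoc)
  also have "\<dots> = ?p \<otimes> (full_twist \<otimes> s 1)"
    unfolding zp using c by (simp add: m_assoc)
  also have "\<dots> = ?p \<otimes> s 1 \<otimes> full_twist"
    unfolding first using c by (simp add: m_assoc)
  also have "\<dots> = s i \<otimes> (full_twist \<otimes> ?p)"
    unfolding shift zp using c by (simp add: m_assoc)
  finally have "full_twist \<otimes> s i \<otimes> ?p = s i \<otimes> full_twist \<otimes> ?p"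
    using c by (simp add: m_assoc)
  then show ?thesis
    using c by (metis right_cancel m_closed)
qed

lemma full_twist_central:
  assumes "g \<in> generate G (s ` {1..m})"
  shows "full_twist \<otimes> g = g \<otimes> full_twist"
proof -
  note z = full_twist_closed
  have S: "s ` {1..m} \<subseteq> carrier G"
    by (auto intro: s_closed)
  show ?thesis
    using assms
  proof (induction rule: generate.induct)
    case one
    show ?case using z by simp
  next
    case (incl h)
    then show ?case by (auto simp: full_twist_commutes_generator)
  next
    case (inv h)
    then have h: "h \<in> carrier G" "full_twist \<otimes> h = h \<otimes> full_twist"
      using S by (auto simp: full_twist_commutes_generator)
    have "full_twist \<otimes> inv h = inv h \<otimes> (h \<otimes> full_twist) \<otimes> inv h"
      using h(1) z by (simp add: m_assoc[symmetric])
    also have "\<dots> = inv h \<otimes> full_twist"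
      unfolding h(2)[symmetric] using h(1) z by (simp add: m_assoc)
    finally show ?case .
  next
    case (eng g h)
    then have c: "g \<in> carrier G" "h \<in> carrier G"
      using generate_in_carrier[OF S] by auto
    have "full_twist \<otimes> (g \<otimes> h) = g \<otimes> (full_twist \<otimes> h)"
      using c z eng.IH(1) by (metis m_assoc)
    then show ?case
      using c z eng.IH(2) by (metis m_assoc)
  qed
qed

end

section \<open>Welded braids act on colourings\<close>

text \<open>
  An action of the letters that respects inverses and the relations factors through the presented
  group. Words act from left to right, the first letter first.
\<close>

lemma pres_rel_fold:
  assumes rels: "\<And>u v. (u, v) \<in> R \<Longrightarrow> fold f u = fold f v"
    and canc: "\<And>g b. g \<in> S \<Longrightarrow> f (g, \<not> b) \<circ> f (g, b) = id"
    and "(u, v) \<in> pres_rel S R"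
  shows "fold f u = fold f v"
  using assms(3)
proof (induction rule: pres_rel.induct)
  case (cancel g b)
  then show ?case using canc[of g b] by simp
qed (auto simp: rels)

text \<open>
  The two mixed relations \<open>\<alpha>\<^sub>i \<alpha>\<^bsub>i+1\<^esub> \<sigma>\<^sub>i = \<sigma>\<^bsub>i+1\<^esub> \<alpha>\<^sub>i \<alpha>\<^bsub>i+1\<^esub>\<close> and \<open>\<sigma>\<^sub>i \<sigma>\<^bsub>i+1\<^esub> \<alpha>\<^sub>i = \<alpha>\<^bsub>i+1\<^esub> \<sigma>\<^sub>i \<sigma>\<^bsub>i+1\<^esub>\<close> are
  sensitive to the reading direction: when words act from left to right, \<open>\<sigma>\<^sub>i\<close> has to reflect the
  right colour in the left one. Acting from right to left with the same rule would violate the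
  second of them.
\<close>

fun color_step :: "wb_gen \<times> bool \<Rightarrow> (nat \<Rightarrow> int) \<Rightarrow> nat \<Rightarrow> int" where
  "color_step (Alpha i, b) x = x(i := x (i + 1), i + 1 := x i)"
| "color_step (Sigma i, True) x = x(i := 2 * x i - x (i + 1), i + 1 := x i)"
| "color_step (Sigma i, False) x = x(i := x (i + 1), i + 1 := 2 * x (i + 1) - x i)"

lemma color_invariant:
  assumes "(u, v) \<in> pres_rel (wb_gens n) (wb_rels n)"
  shows "fold color_step u = fold color_step v"
proof (rule pres_rel_fold[OF _ _ assms])
  fix g b
  show "color_step (g, \<not> b) \<circ> color_step (g, b) = id"
    by (cases g; cases b) (auto simp: fun_eq_iff)
next
  fix u v
  assume "(u, v) \<in> wb_rels n"
  then show "fold color_step u = fold color_step v"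
    unfolding wb_rels_def
    by (elim UnE CollectE exE conjE) (auto simp: fun_eq_iff)
qed

definition delta_word :: "nat \<Rightarrow> wb_gen gword" where
  "delta_word k = map (\<lambda>i. (Sigma i, True)) [1..<Suc k]"

lemma delta_word_Suc: "delta_word (Suc k) = delta_word k @ wb_s (Suc k)"
  by (simp add: delta_word_def)

text \<open>
  Under \<open>\<sigma>\<^sub>1 \<dots> \<sigma>\<^sub>k\<close> the first colour travels to position \<open>k + 1\<close>, and every colour that it
  passes is reflected in it.
\<close>

lemma color_delta:
  "fold color_step (delta_word k) x =
    (\<lambda>j. if 1 \<le> j \<and> j \<le> k then 2 * x 1 - x (j + 1) else if j = k + 1 then x 1 else x j)"
proof (induction k)
  case (Suc k)
  show ?case
    unfolding delta_word_Suc fold_append o_apply Suc by (auto simp: fun_eq_iff)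
qed (auto simp: delta_word_def)

text \<open>
  As \<open>x\<^sub>1\<close> is fixed by the reflection in \<open>x\<^sub>1\<close>, the word \<open>\<delta> = \<sigma>\<^sub>1 \<dots> \<sigma>\<^bsub>n-1\<^esub>\<close> acts as a cyclic
  shift followed by the reflection of all \<open>n\<close> colours in \<open>x\<^sub>1\<close>. Reflections are affine and hence
  commute with the reflecting rule, so \<open>\<delta>\<^sup>k\<close> shifts cyclically by \<open>k\<close> and then
  applies the composed reflections in \<open>x\<^sub>1, \<dots>, x\<^sub>k\<close>; the right-hand side is this composition written
  out. The periodic extension \<open>z\<close> of \<open>x\<close> expresses the cyclic shift without case distinctions.
\<close>

lemma color_delta_pow:
  assumes n: "n \<ge> 1"
    and per: "\<And>j. z (j + n) = z j"
    and x: "\<And>j. j \<in> {1..n} \<Longrightarrow> x j = z j"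
    and j: "j \<in> {1..n}"
  shows "fold color_step (concat (replicate k (delta_word (n - 1)))) x j =
    (- 1) ^ k * z (k + j) + 2 * (\<Sum>i<k. (- 1) ^ i * z (i + 1))"
  using j
proof (induction k arbitrary: j)
  case (Suc k)
  have "concat (replicate (Suc k) w) = concat (replicate k w) @ w" for w :: "wb_gen gword"
    by (induction k) auto
  then show ?case
    using Suc n per[of "k + 1"]
    by (auto simp: color_delta algebra_simps simp del: replicate_Suc)
qed (simp add: x)

lemma full_twist_not_commuting:
  assumes n: "n \<ge> 3"
  defines "z \<equiv> concat (replicate n (delta_word (n - 1)))"
  shows "(z @ wb_a 1, wb_a 1 @ z) \<notin> pres_rel (wb_gens n) (wb_rels n)"
proof
  assume "(z @ wb_a 1, wb_a 1 @ z) \<in> pres_rel (wb_gens n) (wb_rels n)"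
  then have eq: "fold color_step (z @ wb_a 1) = fold color_step (wb_a 1 @ z)"
    by (rule color_invariant)
  \<comment> \<open>The swap by \<open>\<alpha>\<^sub>1\<close> interchanges the unit colourings \<open>e 1\<close> and \<open>e 2\<close>. Position 3, which exists
    because \<open>n \<ge> 3\<close>, has colour 0 in both and is left alone by \<open>\<alpha>\<^sub>1\<close>, so the full twist
    shows its pure translation part there: \<open>2\<close> for \<open>e 1\<close> and \<open>-2\<close> for \<open>e 2\<close>.\<close>
  define e :: "nat \<Rightarrow> nat \<Rightarrow> int" where "e p j = (if j = p then 1 else 0)" for p j
  have alt: "(\<Sum>i<n. (- 1) ^ i * e p ((i + 1) mod n)) = (- 1) ^ (p - 1)" if "p \<in> {1, 2}" for p
  proof -
    have "(\<Sum>i<n. (- 1) ^ i * e p ((i + 1) mod n)) = (\<Sum>i<n. if i = p - 1 then (- 1) ^ i else 0)"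
    proof (intro sum.cong HOL.refl)
      fix i assume "i \<in> {..<n}"
      then show "(- 1) ^ i * e p ((i + 1) mod n) = (if i = p - 1 then (- 1) ^ i else 0)"
        using that n by (cases "i + 1 = n") (auto simp: e_def)
    qed
    then show ?thesis
      using that n by (auto simp: sum.delta)
  qed
  have twist: "fold color_step z (e p) 3 = 2 * (- 1) ^ (p - 1)" if "p \<in> {1, 2}" for p
  proof -
    have "e p ((n + 3) mod n) = 0"
      using that n by (cases "n = 3") (auto simp: e_def)
    moreover have "e p j = e p (j mod n)" if "j \<in> {1..n}" for j
      using that \<open>p \<in> {1, 2}\<close> n by (cases "j = n") (auto simp: e_def)
    ultimately show ?thesis
      unfolding z_def using n color_delta_pow[of n "\<lambda>j. e p (j mod n)" "e p" 3 n] alt[OF that]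
      by simp
  qed
  have "color_step (Alpha 1, True) (e 2) = e 1"
    by (auto simp: fun_eq_iff e_def)
  then have "fold color_step (wb_a 1 @ z) (e 2) 3 = 2"
    using twist[of 1] by simp
  moreover have "fold color_step (z @ wb_a 1) (e 2) 3 = - 2"
    using twist[of 2] by simp
  ultimately show False
    using fun_cong[OF fun_cong[OF eq, of "e 2"], of 3] by (simp only:)
qed

section \<open>From words to the welded braid group\<close>

definition wb_class :: "nat \<Rightarrow> wb_gen gword \<Rightarrow> wb_gen gword set" where
  "wb_class n u = pres_rel (wb_gens n) (wb_rels n) `` {u}"

lemma wb_class_closed: "u \<in> gwords (wb_gens n) \<Longrightarrow> wb_class n u \<in> carrier (WB n)"
  by (simp add: wb_class_def WB_def presented_group_carrierI)

lemma wb_class_mult: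
  "\<lbrakk>u \<in> gwords (wb_gens n); v \<in> gwords (wb_gens n)\<rbrakk>
    \<Longrightarrow> wb_class n u \<otimes>\<^bsub>WB n\<^esub> wb_class n v = wb_class n (u @ v)"
  by (simp add: wb_class_def WB_def presented_group_mult)

lemma wb_class_Nil: "wb_class n [] = \<one>\<^bsub>WB n\<^esub>"
  by (simp add: wb_class_def WB_def presented_group_one)

lemma wb_class_eq_iff:
  assumes "u \<in> gwords (wb_gens n)" "v \<in> gwords (wb_gens n)"
  shows "wb_class n u = wb_class n v \<longleftrightarrow> (u, v) \<in> pres_rel (wb_gens n) (wb_rels n)"
  unfolding wb_class_def using eq_equiv_class_iff[OF equiv_pres_rel assms] .

lemma wb_s_gwords: "\<lbrakk>1 \<le> i; i \<le> n - 1\<rbrakk> \<Longrightarrow> wb_s i \<in> gwords (wb_gens n)"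
  by (auto simp: gwords_def wb_gens_def)

lemma wb_sigma_class: "wb_sigma n i = wb_class n (wb_s i)"
  by (simp add: wb_sigma_def gen_class_def wb_class_def)

lemma wb_braid_relations: "braid_relations (WB n) (wb_sigma n) (n - 1)"
proof (intro braid_relations.intro group_WB braid_relations_axioms.intro)
  fix i assume "1 \<le> i" "i \<le> n - 1"
  then show "wb_sigma n i \<in> carrier (WB n)"
    by (simp add: wb_sigma_class wb_class_closed wb_s_gwords)
next
  fix i j assume ij: "1 \<le> i" "i + 2 \<le> j" "j \<le> n - 1"
  then have "(wb_s i @ wb_s j, wb_s j @ wb_s i) \<in> wb_rels n"
    unfolding wb_rels_def by (simp (no_asm)) auto
  with ij show "wb_sigma n i \<otimes>\<^bsub>WB n\<^esub> wb_sigma n j = wb_sigma n j \<otimes>\<^bsub>WB n\<^esub> wb_sigma n i"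
    using wb_s_gwords[of i n] wb_s_gwords[of j n]
    by (simp only: wb_sigma_class wb_class_mult gwords_append)
      (simp only: wb_class_eq_iff gwords_append pres_rel.relation)
next
  fix i assume i: "1 \<le> i" "i < n - 1"
  then have "(wb_s i @ wb_s (i + 1) @ wb_s i, wb_s (i + 1) @ wb_s i @ wb_s (i + 1)) \<in> wb_rels n"
    unfolding wb_rels_def by (simp (no_asm)) auto
  with i show "wb_sigma n i \<otimes>\<^bsub>WB n\<^esub> wb_sigma n (i + 1) \<otimes>\<^bsub>WB n\<^esub> wb_sigma n i =
      wb_sigma n (i + 1) \<otimes>\<^bsub>WB n\<^esub> wb_sigma n i \<otimes>\<^bsub>WB n\<^esub> wb_sigma n (i + 1)"
    using wb_s_gwords[of i n] wb_s_gwords[of "i + 1" n]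
    by (simp only: wb_sigma_class wb_class_mult gwords_append append_assoc)
      (simp only: wb_class_eq_iff gwords_append pres_rel.relation)
qed

theorem theorem1p1:
  fixes n r :: nat and \<rho> :: "wb_gen gword set \<Rightarrow> complex mat"
  assumes "n \<ge> 3" and "r \<ge> 1"
    and "\<rho> \<in> hom (WB n) (GL r)"
    and "irreducible_rep r (braid_subgroup n) \<rho>"
  shows "\<not> inj_on \<rho> (carrier (WB n))"
proof
  assume inj: "inj_on \<rho> (carrier (WB n))"
  interpret braid_relations "WB n" "wb_sigma n" "n - 1"
    by (rule wb_braid_relations)
  have delta: "delta_word k \<in> gwords (wb_gens n) \<and> delta 1 k = wb_class n (delta_word k)"
    if "k \<le> n - 1" for k
    using that
  proof (induction k)
    case (Suc k)
    have "delta 1 (Suc k) = delta 1 k \<otimes>\<^bsub>WB n\<^esub> wb_class n (wb_s (Suc k))"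
      by (simp add: wb_sigma_class[symmetric])
    with Suc show ?case
      using wb_s_gwords[of "Suc k" n] by (simp add: delta_word_Suc wb_class_mult)
  qed (simp add: delta_word_def wb_class_Nil)
  define w where "w k = concat (replicate k (delta_word (n - 1)))" for k
  have w: "w k \<in> gwords (wb_gens n) \<and> delta 1 (n - 1) [^]\<^bsub>WB n\<^esub> k = wb_class n (w k)" for k
  proof (induction k)
    case (Suc k)
    have "w (Suc k) = w k @ delta_word (n - 1)"
      unfolding w_def by (induction k) auto
    then show ?case
      using Suc delta[of "n - 1"] by (simp add: wb_class_mult)
  qed (simp add: w_def wb_class_Nil)
  have Suc_n: "Suc (n - 1) = n"
    using assms(1) by simp
  define z where "z = wb_class n (w n)"
  define a where "a = wb_class n (wb_a 1)"
  have a_word: "wb_a 1 \<in> gwords (wb_gens n)"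
    using assms(1) by (auto simp: gwords_def wb_gens_def)
  have za: "z \<in> carrier (WB n)" "a \<in> carrier (WB n)"
    using w a_word by (auto simp: z_def a_def wb_class_closed)
  have rho_mult: "\<rho> (g \<otimes>\<^bsub>WB n\<^esub> h) = \<rho> g * \<rho> h"
    if "g \<in> carrier (WB n)" "h \<in> carrier (WB n)" for g h
    using assms(3) that by (simp add: hom_def GL_def units_of_def ring_mat_simps)
  have rho_carrier: "\<rho> g \<in> carrier_mat r r" if "g \<in> carrier (WB n)" for g
    using assms(3) that by (auto simp: hom_def GL_def units_of_def Units_def ring_mat_simps)
  have "\<exists>c. \<rho> z = c \<cdot>\<^sub>m 1\<^sub>m r"
  proof (rule schur_scalar[OF assms(4) rho_carrier[OF za(1)]])
    fix g assume "g \<in> carrier (braid_subgroup n)"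
    then have g: "g \<in> generate (WB n) (wb_sigma n ` {1..n - 1})"
      by (simp add: braid_subgroup_def)
    then have "g \<in> carrier (WB n)"
      by (rule generate_in_carrier[rotated]) (auto intro: s_closed)
    moreover have "z \<otimes>\<^bsub>WB n\<^esub> g = g \<otimes>\<^bsub>WB n\<^esub> z"
      using full_twist_central[OF g] w[of n] by (simp only: z_def full_twist_def Suc_n)
    ultimately show "\<rho> z * \<rho> g = \<rho> g * \<rho> z"
      using za(1) by (simp add: rho_mult[symmetric])
  qed
  then obtain c where c: "\<rho> z = c \<cdot>\<^sub>m 1\<^sub>m r" ..
  have "\<rho> z * \<rho> a = \<rho> a * \<rho> z"
    using rho_carrier[OF za(2)]
    by (simp add: c mult_smult_assoc_mat[of _ r r _ r] mult_smult_distrib[of _ r r _ r])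
  then have "\<rho> (z \<otimes>\<^bsub>WB n\<^esub> a) = \<rho> (a \<otimes>\<^bsub>WB n\<^esub> z)"
    using za by (simp add: rho_mult)
  then have "z \<otimes>\<^bsub>WB n\<^esub> a = a \<otimes>\<^bsub>WB n\<^esub> z"
    using inj za by (simp add: inj_on_eq_iff)
  then have "(w n @ wb_a 1, wb_a 1 @ w n) \<in> pres_rel (wb_gens n) (wb_rels n)"
    using w[of n] a_word
    by (simp only: z_def a_def wb_class_mult wb_class_eq_iff gwords_append)
  then show False
    using full_twist_not_commuting[OF assms(1)] by (simp add: w_def)
qed

end
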